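(* Let $\mathbb{B}$ be a Suslin algebra. Then $\mathbb{B}$ is weakly $(2^{\omega_1},\omega_1)$-distributive and $\mathbb{B}$ is $(\omega,2)$-distributive, but $\mathbb{B}$ is not $(\omega_1,2)$-distributive.
   Context: For ordinals $\mu,\nu$, a complete Boolean algebra $\mathbb{B}$ is $(\mu,\nu)$-distributive iff for every family $\langle u_{\alpha,\beta} \in \mathbb{B} : \alpha<\mu, \beta<\nu\rangle$, $\prod_{\alpha<\mu}\sum_{\beta<\nu} u_{\alpha,\beta} = \sum_{f:\mu\to\nu}\prod_{\alpha<\mu} u_{\alpha,f(\alpha)}$. It is weakly $(\mu,\nu)$-distributive iff for every such family, $\prod_{\alpha<\mu}\sum_{\beta<\nu} u_{\alpha,\beta} = \sum_{g:\mu\to\nu}\prod_{\alpha<\mu}\sum_{\beta<g(\alpha)} u_{\alpha,\beta}$. (Here $\prod$ and $\sum$ are infima and suprema in $\mathbb{B}$.) A Suslin algebra is a (nontrivial, i.e. $0\ne 1$) complete Boolean algebra that is atomless, $(\omega,\kappa)$-distributive for each cardinal $\kappa$, and c.c.c. (every antichain is countable). *)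

theory Defs
  imports Main "HOL-Library.Countable_Set"
begin

text \<open>
  A complete Boolean algebra is a type of sort \<open>{boolean_algebra, complete_lattice}\<close>.
  The library class \<open>complete_boolean_algebra\<close> is not used: it demands complete
  distributivity, hence excludes nontrivial atomless algebras.

  An ordinal is a well-order \<open>r\<close> on its field. Its elements are those of \<open>Field r\<close>, and
  \<open>underS r a\<close> is the set of elements strictly below \<open>a\<close>. Only the values of a family on
  \<open>Field \<mu> \<times> Field \<nu>\<close> matter below. Cardinals are initial ordinals, that is,
  relations satisfying \<open>Card_order\<close>.
\<close>

definition distributive ::
    "'a::{boolean_algebra, complete_lattice} itself \<Rightarrow> 'i rel \<Rightarrow> 'j rel \<Rightarrow> bool" where
  "distributive _ \<mu> \<nu> \<longleftrightarrow>
     (\<forall>u :: 'i \<Rightarrow> 'j \<Rightarrow> 'a.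
        (INF \<alpha>\<in>Field \<mu>. SUP \<beta>\<in>Field \<nu>. u \<alpha> \<beta>) =
        (SUP f\<in>{f. \<forall>\<alpha>\<in>Field \<mu>. f \<alpha> \<in> Field \<nu>}. INF \<alpha>\<in>Field \<mu>. u \<alpha> (f \<alpha>)))"

definition weakly_distributive ::
    "'a::{boolean_algebra, complete_lattice} itself \<Rightarrow> 'i rel \<Rightarrow> 'j rel \<Rightarrow> bool" where
  "weakly_distributive _ \<mu> \<nu> \<longleftrightarrow>
     (\<forall>u :: 'i \<Rightarrow> 'j \<Rightarrow> 'a.
        (INF \<alpha>\<in>Field \<mu>. SUP \<beta>\<in>Field \<nu>. u \<alpha> \<beta>) =
        (SUP g\<in>{g. \<forall>\<alpha>\<in>Field \<mu>. g \<alpha> \<in> Field \<nu>}.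
            INF \<alpha>\<in>Field \<mu>. SUP \<beta>\<in>underS \<nu> (g \<alpha>). u \<alpha> \<beta>))"

definition atom :: "'a::boolean_algebra \<Rightarrow> bool" where
  "atom a \<longleftrightarrow> a \<noteq> bot \<and> (\<forall>b. b \<le> a \<longrightarrow> b = bot \<or> b = a)"

definition atomless :: "'a::boolean_algebra itself \<Rightarrow> bool" where
  "atomless _ \<longleftrightarrow> (\<nexists>a :: 'a. atom a)"

definition antichain :: "'a::boolean_algebra set \<Rightarrow> bool" where
  "antichain A \<longleftrightarrow> bot \<notin> A \<and> pairwise (\<lambda>a b. inf a b = bot) A"

definition ccc :: "'a::boolean_algebra itself \<Rightarrow> bool" where
  "ccc _ \<longleftrightarrow> (\<forall>A :: 'a set. antichain A \<longrightarrow> countable A)"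

text \<open>
  HOL cannot quantify over types inside a formula, so \<open>\<kappa>\<close> ranges over the cardinals
  represented on the algebra's own type, which are those up to its cardinality.
  The lemma \<open>suslin_algebra_distributive\<close> gives all other cardinals.
\<close>

definition suslin_algebra :: "'a::{boolean_algebra, complete_lattice} itself \<Rightarrow> bool" where
  "suslin_algebra B \<longleftrightarrow>
     (bot :: 'a) \<noteq> top \<and>
     atomless B \<and>
     (\<forall>\<kappa> :: 'a rel. Card_order \<kappa> \<longrightarrow> distributive B natLeq \<kappa>) \<and>
     ccc B"

abbreviation two :: "bool rel" where
  "two \<equiv> BNF_Cardinal_Arithmetic.ctwo"

abbreviation omega :: "nat rel" where
  "omega \<equiv> natLeq"

abbreviation omega1 :: "nat set rel" where
  "omega1 \<equiv> cardSuc natLeq"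

abbreviation two_to_omega1 :: "(nat set \<Rightarrow> bool) rel" where
  "two_to_omega1 \<equiv> BNF_Cardinal_Arithmetic.cexp two omega1"

lemma suslin_algebra_distributive:
  fixes \<kappa> :: "'k rel"
  assumes "suslin_algebra TYPE('a::{boolean_algebra, complete_lattice})"
  shows "distributive TYPE('a) natLeq \<kappa>"
  unfolding distributive_def
proof
  fix u :: "nat \<Rightarrow> 'k \<Rightarrow> 'a"
  let ?K = "Field \<kappa>"
  let ?I = "INF n\<in>Field natLeq. SUP \<beta>\<in>?K. u n \<beta>"
  let ?S = "SUP f\<in>{f. \<forall>n\<in>Field natLeq. f n \<in> ?K}. INF n\<in>Field natLeq. u n (f n)"
  define v where "v n a = (if a \<in> u n ` ?K then a else bot)" for n and a :: 'a
  have "distributive TYPE('a) natLeq (card_of (UNIV :: 'a set))"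
    using assms card_of_Card_order by (auto simp: suslin_algebra_def)
  then have v: "(INF n. SUP a. v n a) = (SUP f. INF n. v n (f n))"
    by (simp add: distributive_def Field_natLeq Field_card_of)
  have "?S \<le> ?I"
    by (auto intro!: SUP_least INF_greatest intro: INF_lower2 SUP_upper)
  moreover have "?I \<le> ?S"
  proof -
    have "?I \<le> (INF n. SUP a. v n a)"
    proof (rule INF_mono)
      fix n
      show "\<exists>m\<in>Field natLeq. (SUP \<beta>\<in>?K. u m \<beta>) \<le> (SUP a. v n a)"
      proof (rule bexI[of _ n])
        show "(SUP \<beta>\<in>?K. u n \<beta>) \<le> (SUP a. v n a)"
        proof (rule SUP_least)
          fix \<beta> assume "\<beta> \<in> ?K"
          then have "v n (u n \<beta>) = u n \<beta>" by (simp add: v_def)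
          then show "u n \<beta> \<le> (SUP a. v n a)" using SUP_upper[of "u n \<beta>" UNIV "v n"] by simp
        qed
      qed (simp add: Field_natLeq)
    qed
    also have "\<dots> \<le> ?S"
      unfolding v
    proof (rule SUP_least)
      fix f :: "nat \<Rightarrow> 'a"
      show "(INF n. v n (f n)) \<le> ?S"
      proof (cases "\<forall>n. f n \<in> u n ` ?K")
        case True
        then have "\<forall>n. \<exists>\<beta>. \<beta> \<in> ?K \<and> f n = u n \<beta>" by blast
        then obtain g where g: "\<And>n. g n \<in> ?K \<and> f n = u n (g n)" by metis
        then have "v n (f n) = u n (g n)" for n by (auto simp: v_def)
        then have "(INF n. v n (f n)) = (INF n\<in>Field natLeq. u n (g n))"
          by (simp add: Field_natLeq)
        also have "\<dots> \<le> ?S" using g by (intro SUP_upper) simp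
        finally show ?thesis .
      next
        case False
        then obtain n where "f n \<notin> u n ` ?K" by blast
        then have "v n (f n) = bot" by (simp add: v_def)
        moreover have "(INF n. v n (f n)) \<le> v n (f n)" by (rule INF_lower) simp
        ultimately have "(INF n. v n (f n)) = bot" by (simp add: bot_unique)
        then show ?thesis by simp
      qed
    qed
    finally show ?thesis .
  qed
  ultimately show "?I = ?S" by (rule antisym[rotated])
qed

end

theory Submission
  imports Defs "HOL-Library.Countable_Set_Type"
begin

text \<open>
  Only the third claim needs an idea. Distributivity at \<open>(\<omega>, 2)\<close> is an instance of the
  distributivity that a Suslin algebra has by definition, and weak distributivity follows from
  c.c.c. alone, for every ordinal \<open>\<mu>\<close> in place of \<open>2\<^sup>\<omega>\<^sup>1\<close>: an \<open>\<omega>\<^sub>1\<close>-indexed supremum is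
  already reached at some countable stage \<open>\<gamma>\<close> (\<open>omega1_SUP_eq_SUP_underS\<close>), so taking
  \<open>g(\<alpha>) = \<gamma>\<close> for each row \<open>\<alpha>\<close> gives a single \<open>g\<close> that attains the left-hand side.

  \<^medskip>
  No nontrivial atomless c.c.c. algebra is \<open>(\<omega>\<^sub>1, 2)\<close>-distributive. A set \<open>C\<close> cuts the
  algebra into cells, the nonzero meets obtained by choosing \<open>a\<close> or \<open>- a\<close> for every
  \<open>a \<in> C\<close>. The cells form an antichain, so by c.c.c. there are only countably many of them.
  As the algebra is atomless, a splitter \<open>s\<close> can be fixed that sends every nonzero element to
  a proper nonzero part of it. By recursion on \<open>\<alpha> < \<omega>\<^sub>1\<close>, let stage \<open>\<alpha>\<close> consist
  of the \<open>s\<close>-parts of all cells of all earlier stages; every stage contributes countably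
  many new elements, so the union \<open>A\<close> of these parts has at most \<open>\<omega>\<^sub>1\<close>
  elements and can be enumerated as \<open>g(\<alpha>)\<close>, \<open>\<alpha> < \<omega>\<^sub>1\<close>.

  Consider the family with rows \<open>g(\<alpha>), - g(\<alpha>)\<close>. Every row has supremum \<open>1\<close>. If a choice of
  signs had a nonzero meet \<open>b\<close>, then \<open>b\<close> would lie in one cell \<open>q(\<alpha>)\<close> of every stage
  \<open>\<alpha>\<close>. Each of these cells is cut in two by \<open>s(q(\<alpha>))\<close>, and only one half can meet the
  cells chosen later. The discarded halves form an antichain of size \<open>\<omega>\<^sub>1\<close>
  (\<open>ccc_no_omega1_disjoint_family\<close>), contradicting c.c.c. Hence the right-hand side of the
  distributive law is \<open>0\<close>.
\<close>

unbundle cardinal_syntax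

section \<open>The ordinal \<open>\<omega>\<^sub>1\<close>\<close>

lemma omega1_Card_order: "Card_order omega1"
  by (simp add: cardSuc_Card_order natLeq_Card_order)

lemma omega1_infinite: "infinite (Field omega1)"
  using cardSuc_finite[OF natLeq_Card_order] by (simp add: Field_natLeq)

lemma wo_rel_omega1: "wo_rel omega1"
  unfolding wo_rel_def using omega1_Card_order card_order_on_well_order_on by blast

lemma underS_omega1_subset: "underS omega1 \<gamma> \<subseteq> Field omega1"
  by (auto simp: underS_def Field_def)

lemma omega1_linear:
  assumes "\<alpha> \<in> Field omega1" "\<beta> \<in> Field omega1" "\<alpha> \<noteq> \<beta>"
  shows "\<alpha> \<in> underS omega1 \<beta> \<or> \<beta> \<in> underS omega1 \<alpha>"
  using wo_rel.TOTALS[OF wo_rel_omega1] assms by (auto simp: underS_def)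

lemma underS_omega1_trans:
  assumes "\<alpha> \<in> underS omega1 \<beta>" "\<beta> \<in> underS omega1 \<gamma>"
  shows "\<alpha> \<in> underS omega1 \<gamma>"
  using assms transD[OF wo_rel.TRANS[OF wo_rel_omega1]] antisymD[OF wo_rel.ANTISYM[OF wo_rel_omega1]]
  unfolding underS_def by blast

lemma uncountable_Field_omega1: "uncountable (Field omega1)"
proof
  assume "countable (Field omega1)"
  then have "|Field omega1| \<le>o natLeq" by (simp add: countable_card_le_natLeq)
  moreover have "omega1 =o |Field omega1|"
    using card_of_Field_ordIso[OF omega1_Card_order] ordIso_symmetric by blast
  ultimately have "omega1 \<le>o natLeq" using ordIso_ordLeq_trans by blast
  then show False
    using cardSuc_greater[OF natLeq_Card_order] not_ordLess_ordLeq by blast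
qed

lemma countable_underS_omega1: "countable (underS omega1 \<alpha>)"
proof (cases "\<alpha> \<in> Field omega1")
  case True
  then have "|underS omega1 \<alpha>| <o omega1" by (rule card_of_underS[OF omega1_Card_order])
  then show ?thesis
    unfolding countable_card_le_natLeq
    by (rule cardSuc_ordLeq_ordLess[OF natLeq_Card_order card_of_Card_order, THEN iffD1])
next
  case False
  then have "underS omega1 \<alpha> = {}" by (auto simp: underS_def Field_def)
  then show ?thesis by simp
qed

lemma countable_bounded_omega1:
  assumes "countable N" "N \<subseteq> Field omega1"
  obtains \<gamma> where "\<gamma> \<in> Field omega1" "N \<subseteq> underS omega1 \<gamma>"
proof -
  have "\<not> cofinal N omega1"
  proof
    assume "cofinal N omega1"
    then have "|N| =o omega1"
      using regularCard_cardSuc[OF natLeq_Cinfinite] assms(2) by (auto simp: regularCard_def)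
    moreover have "omega1 =o |Field omega1|"
      using card_of_Field_ordIso[OF omega1_Card_order] ordIso_symmetric by blast
    ultimately have "|Field omega1| \<le>o |N|"
      using ordIso_transitive ordIso_symmetric ordIso_iff_ordLeq by blast
    then show False
      using countable_ordLeq[OF _ assms(1)] uncountable_Field_omega1 by blast
  qed
  then obtain \<delta> where \<delta>: "\<delta> \<in> Field omega1" "\<And>\<beta>. \<beta> \<in> N \<Longrightarrow> \<delta> = \<beta> \<or> (\<delta>, \<beta>) \<notin> omega1"
    unfolding cofinal_def by blast
  obtain \<gamma> where \<gamma>: "\<gamma> \<in> Field omega1" "\<delta> \<noteq> \<gamma>" "(\<delta>, \<gamma>) \<in> omega1"
    using infinite_Card_order_limit[OF omega1_Card_order omega1_infinite \<delta>(1)] by blast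
  have "\<delta> \<in> underS omega1 \<gamma>" using \<gamma> by (auto simp: underS_def)
  moreover have "\<beta> = \<delta> \<or> \<beta> \<in> underS omega1 \<delta>" if "\<beta> \<in> N" for \<beta>
    using omega1_linear[of \<beta> \<delta>] \<delta> that assms(2) by (auto simp: underS_def)
  ultimately have "N \<subseteq> underS omega1 \<gamma>" using underS_omega1_trans by blast
  with \<gamma>(1) show thesis by (rule that)
qed

lemma omega1_induct [consumes 1, case_names less]:
  assumes "\<alpha> \<in> Field omega1"
    and "\<And>\<alpha>. \<alpha> \<in> Field omega1 \<Longrightarrow> (\<And>\<beta>. \<beta> \<in> underS omega1 \<alpha> \<Longrightarrow> P \<beta>) \<Longrightarrow> P \<alpha>"
  shows "P \<alpha>"
  using assms(1)
proof (induction \<alpha> rule: wf_induct_rule[OF wo_rel.WF[OF wo_rel_omega1]])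
  case (1 \<alpha>)
  have "P \<beta>" if "\<beta> \<in> underS omega1 \<alpha>" for \<beta>
    using 1(1)[of \<beta>] that underS_omega1_subset[of \<alpha>] by (auto simp: underS_def)
  then show ?case using assms(2) 1(2) by blast
qed

section \<open>Suprema along \<open>\<omega>\<^sub>1\<close> under c.c.c.\<close>

lemma ccc_disjoint_family_countable:
  fixes t :: "'i \<Rightarrow> 'a::{boolean_algebra, complete_lattice}"
  assumes "ccc TYPE('a)"
    and nz: "\<And>i. i \<in> I \<Longrightarrow> t i \<noteq> bot"
    and disj: "\<And>i j. i \<in> I \<Longrightarrow> j \<in> I \<Longrightarrow> i \<noteq> j \<Longrightarrow> inf (t i) (t j) = bot"
  shows "countable I"
proof -
  have "antichain (t ` I)"
    unfolding antichain_def pairwise_def using nz disj by fastforce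
  then have "countable (t ` I)" using assms(1) by (simp add: ccc_def)
  moreover have "inj_on t I"
    by (rule inj_onI) (metis nz disj inf.idem)
  ultimately show ?thesis using countable_image_inj_on by blast
qed

lemma ccc_omega1_disjoint_family_countable:
  fixes t :: "nat set \<Rightarrow> 'a::{boolean_algebra, complete_lattice}"
  assumes ccc: "ccc TYPE('a)" and I: "I \<subseteq> Field omega1"
    and nz: "\<And>\<alpha>. \<alpha> \<in> I \<Longrightarrow> t \<alpha> \<noteq> bot"
    and disj: "\<And>\<alpha> \<beta>. \<alpha> \<in> I \<Longrightarrow> \<beta> \<in> I \<Longrightarrow> \<alpha> \<in> underS omega1 \<beta> \<Longrightarrow> inf (t \<alpha>) (t \<beta>) = bot"
  shows "countable I"
proof (rule ccc_disjoint_family_countable[OF ccc, where t = t])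
  fix \<alpha> \<beta> assume "\<alpha> \<in> I" "\<beta> \<in> I" "\<alpha> \<noteq> \<beta>"
  then show "inf (t \<alpha>) (t \<beta>) = bot"
    using omega1_linear[of \<alpha> \<beta>] I disj[of \<alpha> \<beta>] disj[of \<beta> \<alpha>] by (auto simp: inf_commute)
qed (rule nz)

corollary ccc_no_omega1_disjoint_family:
  fixes t :: "nat set \<Rightarrow> 'a::{boolean_algebra, complete_lattice}"
  assumes "ccc TYPE('a)"
    and "\<And>\<alpha>. \<alpha> \<in> Field omega1 \<Longrightarrow> t \<alpha> \<noteq> bot"
    and "\<And>\<alpha> \<beta>. \<beta> \<in> Field omega1 \<Longrightarrow> \<alpha> \<in> underS omega1 \<beta> \<Longrightarrow> inf (t \<alpha>) (t \<beta>) = bot"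
  shows False
  using ccc_omega1_disjoint_family_countable[OF assms(1) subset_refl, of t] assms(2,3)
    uncountable_Field_omega1 by blast

text \<open>
  Subtract from each \<open>u \<beta>\<close> everything that comes before it. The nonzero differences are
  disjoint, so they occur only below some countable \<open>\<gamma>\<close>; from \<open>\<gamma>\<close> on, nothing new is added.
\<close>
lemma omega1_SUP_eq_SUP_underS:
  fixes u :: "nat set \<Rightarrow> 'a::{boolean_algebra, complete_lattice}"
  assumes "ccc TYPE('a)"
  obtains \<gamma> where "\<gamma> \<in> Field omega1"
    and "(SUP \<beta>\<in>Field omega1. u \<beta>) = (SUP \<beta>\<in>underS omega1 \<gamma>. u \<beta>)"
proof -
  define v where "v \<beta> = inf (u \<beta>) (- (SUP \<delta>\<in>underS omega1 \<beta>. u \<delta>))" for \<beta>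
  define N where "N = {\<beta> \<in> Field omega1. v \<beta> \<noteq> bot}"
  have "countable N"
  proof (rule ccc_omega1_disjoint_family_countable[OF assms, where t = v])
    fix \<alpha> \<beta> assume "\<alpha> \<in> underS omega1 \<beta>"
    then have "u \<alpha> \<le> (SUP \<delta>\<in>underS omega1 \<beta>. u \<delta>)" by (rule SUP_upper)
    then have "v \<alpha> \<le> (SUP \<delta>\<in>underS omega1 \<beta>. u \<delta>)" by (simp add: v_def le_infI1)
    moreover have "v \<beta> \<le> - (SUP \<delta>\<in>underS omega1 \<beta>. u \<delta>)" by (simp add: v_def)
    ultimately show "inf (v \<alpha>) (v \<beta>) = bot" 
      by (metis bot.extremum_uniqueI inf_compl_bot inf_mono)
  qed (auto simp: N_def)
  then obtain \<gamma> where \<gamma>: "\<gamma> \<in> Field omega1" "N \<subseteq> underS omega1 \<gamma>"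
    using countable_bounded_omega1[of N] by (auto simp: N_def)
  let ?S = "SUP \<beta>\<in>underS omega1 \<gamma>. u \<beta>"
  have le: "u \<beta> \<le> ?S" if "\<beta> \<in> Field omega1" for \<beta>
    using that
  proof (induction rule: omega1_induct)
    case (less \<beta>)
    show ?case
    proof (cases "\<beta> \<in> underS omega1 \<gamma>")
      case True
      then show ?thesis by (rule SUP_upper)
    next
      case False
      then have "v \<beta> = bot" using \<gamma>(2) less(1) by (auto simp: N_def)
      then have "u \<beta> \<le> (SUP \<delta>\<in>underS omega1 \<beta>. u \<delta>)"
        by (simp add: v_def inf_shunt)
      also have "\<dots> \<le> ?S" by (rule SUP_least) (rule less.IH)
      finally show ?thesis .
    qed
  qed
  have "(SUP \<beta>\<in>Field omega1. u \<beta>) = ?S"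
    by (rule antisym[OF SUP_least[OF le] SUP_subset_mono[OF underS_omega1_subset order_refl]])
  with \<gamma>(1) show thesis by (rule that)
qed

proposition ccc_weakly_distributive_omega1:
  assumes "ccc TYPE('a::{boolean_algebra, complete_lattice})"
  shows "weakly_distributive TYPE('a) \<mu> omega1"
  unfolding weakly_distributive_def
proof (intro allI antisym)
  fix u :: "'b \<Rightarrow> nat set \<Rightarrow> 'a"
  let ?G = "{g. \<forall>\<alpha>\<in>Field \<mu>. g \<alpha> \<in> Field omega1}"
  have "\<exists>\<gamma>. \<gamma> \<in> Field omega1
      \<and> (SUP \<beta>\<in>Field omega1. u \<alpha> \<beta>) = (SUP \<beta>\<in>underS omega1 \<gamma>. u \<alpha> \<beta>)" for \<alpha>
    by (rule omega1_SUP_eq_SUP_underS[OF assms, of "u \<alpha>"]) blast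
  then obtain g where g: "\<And>\<alpha>. g \<alpha> \<in> Field omega1"
    "\<And>\<alpha>. (SUP \<beta>\<in>Field omega1. u \<alpha> \<beta>) = (SUP \<beta>\<in>underS omega1 (g \<alpha>). u \<alpha> \<beta>)"
    by metis
  have "(INF \<alpha>\<in>Field \<mu>. SUP \<beta>\<in>Field omega1. u \<alpha> \<beta>)
      = (INF \<alpha>\<in>Field \<mu>. SUP \<beta>\<in>underS omega1 (g \<alpha>). u \<alpha> \<beta>)"
    by (simp only: g(2))
  also have "\<dots> \<le> (SUP g\<in>?G. INF \<alpha>\<in>Field \<mu>. SUP \<beta>\<in>underS omega1 (g \<alpha>). u \<alpha> \<beta>)"
    using g(1) by (intro SUP_upper) simp
  finally show "(INF \<alpha>\<in>Field \<mu>. SUP \<beta>\<in>Field omega1. u \<alpha> \<beta>)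
      \<le> (SUP g\<in>?G. INF \<alpha>\<in>Field \<mu>. SUP \<beta>\<in>underS omega1 (g \<alpha>). u \<alpha> \<beta>)" .
  show "(SUP g\<in>?G. INF \<alpha>\<in>Field \<mu>. SUP \<beta>\<in>underS omega1 (g \<alpha>). u \<alpha> \<beta>)
      \<le> (INF \<alpha>\<in>Field \<mu>. SUP \<beta>\<in>Field omega1. u \<alpha> \<beta>)"
    by (rule SUP_least)
      (rule INF_mono'[OF SUP_subset_mono[OF underS_omega1_subset order_refl]])
qed

section \<open>Cells and their iterated splitting\<close>

definition cell :: "'a::{boolean_algebra, complete_lattice} set \<Rightarrow> 'a set \<Rightarrow> 'a" where
  "cell C D = (INF a\<in>C. if a \<in> D then a else - a)"

definition cells :: "'a::{boolean_algebra, complete_lattice} set \<Rightarrow> 'a set" where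
  "cells C = range (cell C) - {bot}"

lemma cell_le: "a \<in> C \<Longrightarrow> cell C D \<le> (if a \<in> D then a else - a)"
  unfolding cell_def by (rule INF_lower)

text \<open>
  Distinct cells come from sign choices that disagree at some \<open>a \<in> C\<close>, so one of them lies
  below \<open>a\<close> and the other below \<open>- a\<close>.
\<close>
lemma antichain_cells: "antichain (cells C)"
proof -
  have "inf (cell C D) (cell C E) = bot" if "cell C D \<noteq> cell C E" for D E
  proof -
    have "cell C D = cell C E" if "\<And>a. a \<in> C \<Longrightarrow> (a \<in> D) = (a \<in> E)"
      unfolding cell_def by (rule INF_cong) (simp_all add: that)
    with that obtain a where a: "a \<in> C" "(a \<in> D) \<noteq> (a \<in> E)" by blast
    have "inf (cell C D) (cell C E) \<le> inf (if a \<in> D then a else - a) (if a \<in> E then a else - a)"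
      by (intro inf_mono cell_le a(1))
    also have "\<dots> = bot" using a(2) by auto
    finally show ?thesis by (simp add: bot_unique)
  qed
  then show ?thesis unfolding antichain_def cells_def pairwise_def by auto
qed

lemma ccc_countable_cells:
  fixes C :: "'a::{boolean_algebra, complete_lattice} set"
  assumes "ccc TYPE('a)"
  shows "countable (cells C)"
  using assms antichain_cells by (auto simp: ccc_def)

lemma atomless_splitter:
  assumes "atomless TYPE('a::boolean_algebra)"
  obtains s :: "'a::boolean_algebra \<Rightarrow> 'a" where "\<And>p. p \<noteq> bot \<Longrightarrow> s p \<noteq> bot" "\<And>p. p \<noteq> bot \<Longrightarrow> s p < p"
proof -
  have "\<forall>p :: 'a. \<exists>q. p \<noteq> bot \<longrightarrow> q \<noteq> bot \<and> q < p"
    using assms unfolding atomless_def atom_def by (metis order_le_less)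
  then show thesis using that by metis
qed

definition stage :: "('a::{boolean_algebra, complete_lattice} \<Rightarrow> 'a) \<Rightarrow> nat set \<Rightarrow> 'a set" where
  "stage s = wfrec (omega1 - Id) (\<lambda>f \<alpha>. \<Union>\<beta>\<in>underS omega1 \<alpha>. s ` cells (f \<beta>))"

lemma stage_eq: "stage s \<alpha> = (\<Union>\<beta>\<in>underS omega1 \<alpha>. s ` cells (stage s \<beta>))"
proof -
  have "stage s \<alpha> = (\<Union>\<beta>\<in>underS omega1 \<alpha>. s ` cells (cut (stage s) (omega1 - Id) \<alpha> \<beta>))"
    unfolding stage_def by (subst wfrec[OF wo_rel.WF[OF wo_rel_omega1]]) (rule refl)
  also have "\<dots> = (\<Union>\<beta>\<in>underS omega1 \<alpha>. s ` cells (stage s \<beta>))"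
    by (intro SUP_cong refl) (simp add: cut_apply underS_def)
  finally show ?thesis .
qed

text \<open>
  The chain of cells \<open>q \<alpha> \<ge> b\<close> descends strictly along \<open>\<omega>\<^sub>1\<close>: the splitting element
  \<open>s (q \<alpha>)\<close> belongs to every later stage, so each later \<open>q \<beta>\<close> lies entirely on the side of it
  that contains \<open>b\<close>, and the other half of \<open>q \<alpha>\<close> is lost for good.
\<close>
lemma ccc_no_deciding_element:
  fixes b :: "'a::{boolean_algebra, complete_lattice}"
  assumes ccc: "ccc TYPE('a)"
    and s: "\<And>p. p \<noteq> bot \<Longrightarrow> s p \<noteq> bot" "\<And>p. p \<noteq> bot \<Longrightarrow> s p < p"
    and b: "b \<noteq> bot"
    and decided: "\<And>\<alpha> a. \<alpha> \<in> Field omega1 \<Longrightarrow> a \<in> s ` cells (stage s \<alpha>) \<Longrightarrow> b \<le> a \<or> b \<le> - a"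
  shows False
proof -
  define q where "q \<alpha> = cell (stage s \<alpha>) {a. b \<le> a}" for \<alpha>
  define t where "t \<alpha> = (if b \<le> s (q \<alpha>) then inf (q \<alpha>) (- s (q \<alpha>)) else s (q \<alpha>))" for \<alpha>
  have "b \<le> q \<alpha>" for \<alpha>
    unfolding q_def cell_def
  proof (rule INF_greatest)
    fix a assume "a \<in> stage s \<alpha>"
    then obtain \<beta> where "\<beta> \<in> underS omega1 \<alpha>" "a \<in> s ` cells (stage s \<beta>)"
      by (subst (asm) stage_eq) blast
    then have "b \<le> a \<or> b \<le> - a" using decided underS_omega1_subset by blast
    then show "b \<le> (if a \<in> {a. b \<le> a} then a else - a)" by auto
  qed
  then have q_nz: "q \<alpha> \<noteq> bot" for \<alpha> using b by (metis bot_unique)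
  have t_le: "t \<alpha> \<le> q \<alpha>" for \<alpha>
    using s(2)[OF q_nz] by (auto simp: t_def less_imp_le)
  show False
  proof (rule ccc_no_omega1_disjoint_family[OF ccc])
    fix \<alpha> :: "nat set"
    have "\<not> q \<alpha> \<le> s (q \<alpha>)" using s(2)[OF q_nz] by (simp add: less_le_not_le)
    then show "t \<alpha> \<noteq> bot" using s(1)[OF q_nz] by (simp add: t_def inf_shunt)
  next
    fix \<alpha> \<beta> assume "\<alpha> \<in> underS omega1 \<beta>"
    moreover have "q \<alpha> \<in> cells (stage s \<alpha>)" using q_nz by (simp add: cells_def q_def)
    ultimately have "s (q \<alpha>) \<in> stage s \<beta>" by (subst stage_eq) blast
    then have "q \<beta> \<le> (if b \<le> s (q \<alpha>) then s (q \<alpha>) else - s (q \<alpha>))"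
      using cell_le[of "s (q \<alpha>)" "stage s \<beta>" "{a. b \<le> a}"] by (simp add: q_def)
    then have "t \<beta> \<le> (if b \<le> s (q \<alpha>) then s (q \<alpha>) else - s (q \<alpha>))"
      using t_le order_trans by blast
    then have "t \<beta> \<le> - t \<alpha>" by (auto simp: t_def le_supI2 split: if_splits)
    then show "inf (t \<alpha>) (t \<beta>) = bot" by (subst inf_commute) (simp add: inf_shunt)
  qed
qed

proposition atomless_ccc_not_distributive_omega1_two:
  assumes atomless: "atomless TYPE('a::{boolean_algebra, complete_lattice})"
    and ccc: "ccc TYPE('a)" and nontrivial: "(bot :: 'a) \<noteq> top"
  shows "\<not> distributive TYPE('a) omega1 two"
proof
  assume dist: "distributive TYPE('a) omega1 two"
  obtain s :: "'a \<Rightarrow> 'a" where s: "\<And>p. p \<noteq> bot \<Longrightarrow> s p \<noteq> bot" "\<And>p. p \<noteq> bot \<Longrightarrow> s p < p"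
    using atomless_splitter[OF atomless] by blast
  define A where "A = (\<Union>\<alpha>\<in>Field omega1. s ` cells (stage s \<alpha>))"
  have "|s ` cells (stage s \<alpha>)| \<le>o omega1" for \<alpha>
  proof -
    have "|s ` cells (stage s \<alpha>)| \<le>o natLeq"
      using ccc_countable_cells[OF ccc] by (simp flip: countable_card_le_natLeq)
    then show ?thesis
      using cardSuc_ordLeq[OF natLeq_Card_order] ordLeq_transitive by blast
  qed
  then have "|A| \<le>o omega1"
    unfolding A_def
    by (intro card_of_UNION_ordLeq_infinite_Field omega1_infinite omega1_Card_order ballI
        ordIso_imp_ordLeq[OF card_of_Field_ordIso])
  then have A_le: "|A| \<le>o |Field omega1|"
    using card_of_Field_ordIso[OF omega1_Card_order] ordIso_symmetric ordLeq_ordIso_trans by blast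
  have "\<exists>g. A \<subseteq> g ` Field omega1"
  proof (cases "A = {}")
    case False
    then obtain g where "g ` Field omega1 = A"
      using card_of_ordLeq2[of A "Field omega1"] A_le by auto
    then show ?thesis by (intro exI[of _ g]) simp
  qed simp
  then obtain g where g: "A \<subseteq> g ` Field omega1" by (rule exE)
  let ?u = "\<lambda>\<alpha> c. if c then g \<alpha> else - g \<alpha>"
  have bot: "(INF \<alpha>\<in>Field omega1. ?u \<alpha> (f \<alpha>)) = bot" (is "?b = bot") for f
  proof (rule ccontr)
    assume "?b \<noteq> bot"
    from ccc s this show False
    proof (rule ccc_no_deciding_element)
      fix \<alpha> a assume "\<alpha> \<in> Field omega1" "a \<in> s ` cells (stage s \<alpha>)"
      then obtain \<gamma> where \<gamma>: "\<gamma> \<in> Field omega1" "a = g \<gamma>"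
        using g unfolding A_def by blast
      have "?b \<le> ?u \<gamma> (f \<gamma>)" by (rule INF_lower[OF \<gamma>(1)])
      then show "?b \<le> a \<or> ?b \<le> - a" by (cases "f \<gamma>") (simp_all add: \<gamma>(2))
    qed
  qed
  have "(top :: 'a) = (INF \<alpha>\<in>Field omega1. SUP c\<in>Field two. ?u \<alpha> c)"
    by (simp add: ctwo_def Field_card_of UNIV_bool)
  also have "\<dots> = (SUP f\<in>{f. \<forall>\<alpha>\<in>Field omega1. f \<alpha> \<in> Field two}. INF \<alpha>\<in>Field omega1. ?u \<alpha> (f \<alpha>))"
    using dist[unfolded distributive_def, rule_format, of ?u] .
  also have "\<dots> = bot" unfolding bot by simp
  finally show False using nontrivial by simp
qed

section \<open>Suslin algebras\<close>

theorem mainTheorem5: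
  assumes "suslin_algebra TYPE('a::{boolean_algebra, complete_lattice})"
  shows "weakly_distributive TYPE('a) two_to_omega1 omega1 \<and>
         distributive TYPE('a) omega two \<and>
         \<not> distributive TYPE('a) omega1 two"
proof (intro conjI)
  have "ccc TYPE('a)" "atomless TYPE('a)" "(bot :: 'a) \<noteq> top"
    using assms by (simp_all add: suslin_algebra_def)
  then show "weakly_distributive TYPE('a) two_to_omega1 omega1"
    and "\<not> distributive TYPE('a) omega1 two"
    by (simp_all add: ccc_weakly_distributive_omega1 atomless_ccc_not_distributive_omega1_two)
  show "distributive TYPE('a) omega two"
    using assms by (rule suslin_algebra_distributive)
qed

end
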